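(* Consider symmetric matrices of homogeneous polynomials on $\mathbb{P}^3$ $$A=\begin{pmatrix} a_{0,0} & a_{0,1} & a_{0,2} \\ a_{0,1} & a_{1,1} & a_{1,2} \\ a_{0,2} & a_{1,2} & a_{2,2} \end{pmatrix},\qquad B=\begin{pmatrix} b & c \\ c & d \end{pmatrix}$$ defining symmetric maps between graded-free vector bundles. Let $$N=\begin{pmatrix} c^2a_{0,0}-b\det A & c a_{0,1} & c a_{0,2} \\ c a_{0,1} & a_{1,1} & a_{1,2} \\ c a_{0,2} & a_{1,2} & a_{2,2} \end{pmatrix}.$$ If $$d=\det\begin{pmatrix} a_{1,1} & a_{1,2} \\ a_{1,2} & a_{2,2} \end{pmatrix},$$ then $N$ also gives a symmetric map between graded-free vector bundles and $\det N=-(\det A)(\det B)$.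
   Context: The ground field $k$ is algebraically closed of characteristic not $2$. A symmetric $m\times m$ matrix $(m_{ij})$ of homogeneous polynomials on $\mathbb{P}^3$ gives a symmetric map between graded-free vector bundles (direct sums of line bundles $\mathcal{O}(r)$ on $\mathbb{P}^3$) if there are non-negative integers $d_i$, all congruent modulo $2$, such that $m_{ij}$ is homogeneous of degree $(d_i+d_j)/2$ for all $i,j$ (so $\deg m_{ii}=d_i$). The equality $d=\det(\cdot)$ is understood as an equality of homogeneous polynomials of the same degree. *)

theory Defs
  imports "HOL-Analysis.Analysis" "HOL-Library.Poly_Mapping"
begin

text \<open>
  Polynomials over \<open>'k\<close> in four variables (the homogeneous coordinate ring of projective 3-space):
  the variables are indexed by the four-element type \<open>4\<close>, a monomial is its exponent vector
  \<open>4 \<Rightarrow>\<^sub>0 nat\<close>, and multiplication on \<open>\<Rightarrow>\<^sub>0\<close> is convolution.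
\<close>
type_synonym 'k poly_P3 = "(4 \<Rightarrow>\<^sub>0 nat) \<Rightarrow>\<^sub>0 'k"

text \<open>As usual, the zero polynomial is homogeneous of every degree.\<close>
definition homogeneous_of_degree :: "nat \<Rightarrow> 'k::zero poly_P3 \<Rightarrow> bool" where
  "homogeneous_of_degree n p \<longleftrightarrow>
     (\<forall>m \<in> Poly_Mapping.keys p. (\<Sum>i\<in>UNIV. Poly_Mapping.lookup m i) = n)"

text \<open>
  The division by 2 below is exact because of the parity condition.  The degrees \<open>\<delta>\<close> are kept as
  an argument because zero entries of \<open>M\<close> do not determine them.
\<close>
definition symmetric_map_of_degrees ::
    "('n::finite \<Rightarrow> nat) \<Rightarrow> ('k::zero poly_P3)^'n^'n \<Rightarrow> bool" where
  "symmetric_map_of_degrees \<delta> M \<longleftrightarrow>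
     transpose M = M \<and>
     (\<forall>i j. \<delta> i mod 2 = \<delta> j mod 2) \<and>
     (\<forall>i j. homogeneous_of_degree ((\<delta> i + \<delta> j) div 2) (M $ i $ j))"

definition gives_symmetric_map :: "('k::zero poly_P3)^'n::finite^'n \<Rightarrow> bool" where
  "gives_symmetric_map M \<longleftrightarrow> (\<exists>\<delta>. symmetric_map_of_degrees \<delta> M)"

end

theory Submission
  imports Defs
begin

text \<open>
  The determinant identity is a polynomial identity in the entries, once \<open>d\<close> is replaced by the
  lower right minor of \<open>A\<close>: expanding \<open>det N\<close> along its first row gives
  \<open>c\<^sup>2 det A - b d det A\<close>, which is \<open>- det A (b d - c\<^sup>2)\<close>.

  For the grading, let \<open>e = (\<beta>\<^sub>1 + \<beta>\<^sub>2) / 2\<close> be the degree of \<open>c\<close>.  Passing from \<open>A\<close> to \<open>N\<close> multiplies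
  the first row and the first column by \<open>c\<close>, which raises the first degree \<open>\<alpha>\<^sub>1\<close> by \<open>2 e\<close>, and then
  subtracts \<open>b det A\<close> from the corner.  This correction term has degree
  \<open>\<beta>\<^sub>1 + \<alpha>\<^sub>1 + \<alpha>\<^sub>2 + \<alpha>\<^sub>3\<close>, because the determinant of a symmetric map is homogeneous of
  degree the sum of the degrees (\<open>symmetric_map_homogeneous_det\<close>); since
  \<open>\<beta>\<^sub>2 = \<alpha>\<^sub>2 + \<alpha>\<^sub>3\<close>, this is the required degree \<open>\<alpha>\<^sub>1 + 2 e\<close>,
  and the parity of the first degree is unchanged.
\<close>

lemma homogeneous_zero: "homogeneous_of_degree n 0"
  by (simp add: homogeneous_of_degree_def)

lemma homogeneous_one: "homogeneous_of_degree 0 (1 :: 'k::zero_neq_one poly_P3)"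
  by (simp add: homogeneous_of_degree_def)

lemma homogeneous_add:
  fixes p q :: "'k::monoid_add poly_P3"
  assumes "homogeneous_of_degree n p" "homogeneous_of_degree n q"
  shows "homogeneous_of_degree n (p + q)"
  using assms Poly_Mapping.keys_add[of p q] unfolding homogeneous_of_degree_def by blast

lemma homogeneous_uminus:
  fixes p :: "'k::ab_group_add poly_P3"
  assumes "homogeneous_of_degree n p"
  shows "homogeneous_of_degree n (- p)"
  using assms by (simp add: homogeneous_of_degree_def)

lemma homogeneous_diff:
  fixes p q :: "'k::ab_group_add poly_P3"
  assumes "homogeneous_of_degree n p" "homogeneous_of_degree n q"
  shows "homogeneous_of_degree n (p - q)"
  using homogeneous_add[OF assms(1) homogeneous_uminus[OF assms(2)]] by simp

lemma homogeneous_mult: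
  fixes p q :: "'k::semiring_0 poly_P3"
  assumes p: "homogeneous_of_degree m p" and q: "homogeneous_of_degree n q"
  shows "homogeneous_of_degree (m + n) (p * q)"
  unfolding homogeneous_of_degree_def
proof
  fix k assume "k \<in> Poly_Mapping.keys (p * q)"
  then obtain u v where "k = u + v" "u \<in> Poly_Mapping.keys p" "v \<in> Poly_Mapping.keys q"
    using Poly_Mapping.keys_mult[of p q] by blast
  then show "(\<Sum>i\<in>UNIV. Poly_Mapping.lookup k i) = m + n"
    using p q by (simp add: homogeneous_of_degree_def lookup_add sum.distrib)
qed

lemma homogeneous_sum:
  fixes f :: "'a \<Rightarrow> 'k::comm_monoid_add poly_P3"
  assumes "\<And>x. x \<in> S \<Longrightarrow> homogeneous_of_degree n (f x)"
  shows "homogeneous_of_degree n (\<Sum>x\<in>S. f x)"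
  using assms by (induction S rule: infinite_finite_induct)
    (auto simp: homogeneous_zero intro: homogeneous_add)

lemma homogeneous_prod:
  fixes f :: "'a \<Rightarrow> 'k::comm_semiring_1 poly_P3"
  assumes "\<And>x. x \<in> S \<Longrightarrow> homogeneous_of_degree (n x) (f x)"
  shows "homogeneous_of_degree (\<Sum>x\<in>S. n x) (\<Prod>x\<in>S. f x)"
  using assms by (induction S rule: infinite_finite_induct)
    (auto simp: homogeneous_one intro: homogeneous_mult)

text \<open>
  Each term of the Leibniz expansion has degree \<open>\<Sum>i. (\<delta> i + \<delta> (p i)) / 2\<close>, which does not depend on
  the permutation \<open>p\<close>.
\<close>
lemma symmetric_map_homogeneous_det:
  fixes M :: "('k::comm_ring_1 poly_P3)^'n^'n"
  assumes M: "symmetric_map_of_degrees \<delta> M"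
  shows "homogeneous_of_degree (\<Sum>i\<in>UNIV. \<delta> i) (det M)"
  unfolding det_def
proof (rule homogeneous_sum)
  fix p :: "'n \<Rightarrow> 'n" assume "p \<in> {p. p permutes UNIV}"
  then have p: "p permutes UNIV" by simp
  have half: "2 * ((\<delta> i + \<delta> (p i)) div 2) = \<delta> i + \<delta> (p i)" for i
  proof -
    have "\<delta> i mod 2 = \<delta> (p i) mod 2"
      using M by (simp add: symmetric_map_of_degrees_def)
    then show ?thesis by presburger
  qed
  have "2 * (\<Sum>i\<in>UNIV. (\<delta> i + \<delta> (p i)) div 2) = (\<Sum>i\<in>UNIV. \<delta> i) + (\<Sum>i\<in>UNIV. \<delta> (p i))"
    by (simp only: sum_distrib_left half sum.distrib)
  also have "(\<Sum>i\<in>UNIV. \<delta> (p i)) = (\<Sum>i\<in>UNIV. \<delta> i)"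
    using sum.permute[OF p, of \<delta>] by (simp add: o_def)
  finally have degree: "(\<Sum>i\<in>UNIV. (\<delta> i + \<delta> (p i)) div 2) = (\<Sum>i\<in>UNIV. \<delta> i)"
    by simp
  have "homogeneous_of_degree (\<Sum>i\<in>UNIV. (\<delta> i + \<delta> (p i)) div 2) (\<Prod>i\<in>UNIV. M $ i $ p i)"
    by (rule homogeneous_prod) (use M in \<open>simp add: symmetric_map_of_degrees_def\<close>)
  then have "homogeneous_of_degree (\<Sum>i\<in>UNIV. \<delta> i) (\<Prod>i\<in>UNIV. M $ i $ p i)"
    by (simp only: degree)
  then show "homogeneous_of_degree (\<Sum>i\<in>UNIV. \<delta> i) (of_int (sign p) * (\<Prod>i\<in>UNIV. M $ i $ p i))"
    by (cases p rule: sign_cases) (simp_all add: homogeneous_uminus)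
qed

theorem proposition4p1:
  fixes a00 a01 a02 a11 a12 a22 b c d :: "'k::alg_closed_field poly_P3"
    and A N :: "('k poly_P3)^3^3" and B :: "('k poly_P3)^2^2"
    and \<alpha> :: "3 \<Rightarrow> nat" and \<beta> :: "2 \<Rightarrow> nat"
  assumes char: "CHAR('k) \<noteq> 2"
    and A: "A = vector [vector [a00, a01, a02],
                        vector [a01, a11, a12],
                        vector [a02, a12, a22]]"
    and B: "B = vector [vector [b, c],
                        vector [c, d]]"
    and N: "N = vector [vector [c^2 * a00 - b * det A, c * a01, c * a02],
                        vector [c * a01, a11, a12],
                        vector [c * a02, a12, a22]]"
    and map_A: "symmetric_map_of_degrees \<alpha> A"
    and map_B: "symmetric_map_of_degrees \<beta> B"
    and d_eq: "d = det (vector [vector [a11, a12], vector [a12, a22]] :: ('k poly_P3)^2^2)"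
    \<comment> \<open>the equality of \<open>d\<close> with the minor is one of homogeneous polynomials of the same degree;
        this only adds something when both are zero\<close>
    and d_degree: "\<beta> 2 = \<alpha> 2 + \<alpha> 3"
  shows "gives_symmetric_map N \<and> det N = - (det A * det B)"
proof
  have hom_A: "homogeneous_of_degree ((\<alpha> i + \<alpha> j) div 2) (A $ i $ j)" for i j
    using map_A by (simp add: symmetric_map_of_degrees_def)
  have par_A: "\<alpha> 1 mod 2 = \<alpha> 2 mod 2" "\<alpha> 1 mod 2 = \<alpha> 3 mod 2"
    and par_B: "\<beta> 1 mod 2 = \<beta> 2 mod 2"
    using map_A map_B by (simp_all only: symmetric_map_of_degrees_def)
  define e where "e = (\<beta> 1 + \<beta> 2) div 2"
  have e: "2 * e = \<beta> 1 + \<beta> 2"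
    using par_B unfolding e_def by presburger
  have hom_a: "homogeneous_of_degree (\<alpha> 1) a00"
    "homogeneous_of_degree ((\<alpha> 1 + \<alpha> 2) div 2) a01"
    "homogeneous_of_degree ((\<alpha> 1 + \<alpha> 3) div 2) a02"
    "homogeneous_of_degree (\<alpha> 2) a11"
    "homogeneous_of_degree ((\<alpha> 2 + \<alpha> 3) div 2) a12"
    "homogeneous_of_degree (\<alpha> 3) a22"
    using hom_A[of 1 1] hom_A[of 1 2] hom_A[of 1 3] hom_A[of 2 2] hom_A[of 2 3] hom_A[of 3 3]
    by (simp_all add: A)
  have hom_B: "homogeneous_of_degree ((\<beta> i + \<beta> j) div 2) (B $ i $ j)" for i j
    using map_B by (simp add: symmetric_map_of_degrees_def)
  have hom_b: "homogeneous_of_degree (\<beta> 1) b" and hom_c: "homogeneous_of_degree e c"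
    using hom_B[of 1 1] hom_B[of 1 2] by (simp_all add: B e_def)
  have hom_det: "homogeneous_of_degree (\<alpha> 1 + \<alpha> 2 + \<alpha> 3) (det A)"
    using symmetric_map_homogeneous_det[OF map_A] by (simp add: sum_3)

  define \<delta> where "\<delta> = (\<lambda>i. if i = 1 then \<alpha> 1 + 2 * e else \<alpha> i)"
  have \<delta>: "\<delta> 1 = \<alpha> 1 + 2 * e" "\<delta> 2 = \<alpha> 2" "\<delta> 3 = \<alpha> 3"
    by (simp_all add: \<delta>_def)
  have corner: "homogeneous_of_degree (\<alpha> 1 + 2 * e) (c^2 * a00 - b * det A)"
  proof (rule homogeneous_diff)
    show "homogeneous_of_degree (\<alpha> 1 + 2 * e) (c^2 * a00)"
      using homogeneous_mult[OF homogeneous_mult[OF hom_c hom_c] hom_a(1)]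
      by (simp add: power2_eq_square mult_2 add.commute)
    have "\<beta> 1 + (\<alpha> 1 + \<alpha> 2 + \<alpha> 3) = \<alpha> 1 + 2 * e"
      using e d_degree by simp
    then show "homogeneous_of_degree (\<alpha> 1 + 2 * e) (b * det A)"
      using homogeneous_mult[OF hom_b hom_det] by (simp only:)
  qed
  have border: "homogeneous_of_degree ((\<alpha> 1 + 2 * e + \<alpha> 2) div 2) (c * a01)"
    "homogeneous_of_degree ((\<alpha> 1 + 2 * e + \<alpha> 3) div 2) (c * a02)"
  proof -
    have "(\<alpha> 1 + 2 * e + n) div 2 = e + (\<alpha> 1 + n) div 2" for n
      by simp
    then show "homogeneous_of_degree ((\<alpha> 1 + 2 * e + \<alpha> 2) div 2) (c * a01)"
      "homogeneous_of_degree ((\<alpha> 1 + 2 * e + \<alpha> 3) div 2) (c * a02)"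
      using homogeneous_mult[OF hom_c hom_a(2)] homogeneous_mult[OF hom_c hom_a(3)]
      by simp_all
  qed
  have "symmetric_map_of_degrees \<delta> N"
    unfolding symmetric_map_of_degrees_def
  proof (intro conjI)
    show "transpose N = N"
      by (simp add: N transpose_def vec_eq_iff forall_3)
    show "\<forall>i j. \<delta> i mod 2 = \<delta> j mod 2"
      using par_A by (simp add: forall_3 \<delta>)
    show "\<forall>i j. homogeneous_of_degree ((\<delta> i + \<delta> j) div 2) (N $ i $ j)"
      using corner border hom_a by (simp add: forall_3 \<delta> N add.commute)
  qed
  then show "gives_symmetric_map N"
    unfolding gives_symmetric_map_def by blast

  have d: "d = a11 * a22 - a12 * a12"
    by (simp add: d_eq det_2)
  show "det N = - (det A * det B)"
    unfolding N B det_3 det_2 d A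
    by (simp add: algebra_simps power2_eq_square)
qed

end
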